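(* Let $\mathbf{D}_{prior}\in\mathbb{C}^{N\times N}$ satisfy $\mathbf{D}_{prior}^H\mathbf{D}_{prior}=\mathbf{I}$, let $\mathbf{r}_1,\dots,\mathbf{r}_K\in\mathbb{C}^{N\times 1}$ be linearly independent, and let $\mathbf{D}_{post}=\mathbf{D}_{prior}\mathbf{H}_1\cdots\mathbf{H}_K$ be the HOT posterior transform domain with multiple reference knowledge $\mathbf{r}_1,\dots,\mathbf{r}_K$ (defined in the context). Then the relative error and correlation between $\mathbf{D}_{post}$ and $\mathbf{D}_{prior}$ satisfy $$\mathcal{E}(\mathbf{D}_{post},\mathbf{D}_{prior})\le\frac{2\sqrt{K}}{\sqrt{N}},\qquad\rho(\mathbf{D}_{post},\mathbf{D}_{prior})\ge1-\frac{2K}{N},$$ where $$\mathcal{E}(\mathbf{D}_{post},\mathbf{D}_{prior})=\frac{\|\mathbf{D}_{post}-\mathbf{D}_{prior}\|_{\mathrm F}}{\|\mathbf{D}_{prior}\|_{\mathrm F}},\qquad\rho(\mathbf{D}_{post},\mathbf{D}_{prior})=\frac1N\sum_{j=1}^{N}\frac{|\mathbf{D}_{post,j}^H\mathbf{D}_{prior,j}|}{\|\mathbf{D}_{post,j}\|_2\|\mathbf{D}_{prior,j}\|_2}.$$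
   Context: $(\cdot)^H$ denotes conjugate transpose, $\mathbf{e}_j$ is the $j$-th standard basis vector, $\|\cdot\|_{\mathrm F}$ is the Frobenius norm, and $\mathbf{D}_{prior,j}$, $\mathbf{D}_{post,j}$ are $j$-th columns. HOT with multiple reference knowledge: let $\Omega=\{1,\dots,N\}$; for $\mathbf{a}\in\mathbb{C}^N$ and $S\subseteq\Omega$, $\mathbf{a}_S\in\mathbb{C}^N$ agrees with $\mathbf{a}$ on the coordinates in $S$ and is zero elsewhere. Put $\mathbf{w}_i=\mathbf{D}_{prior}^H\mathbf{r}_i$. Choose distinct indices $j_1,\dots,j_K\in\Omega$. For $i=1,\dots,K$ in turn, put $\mathbf{u}_i=\mathbf{H}_{i-1}\cdots\mathbf{H}_1\mathbf{w}_i$ (with $\mathbf{u}_1=\mathbf{w}_1$) and $S_i=\Omega\setminus\{j_1,\dots,j_{i-1}\}$, let $\alpha_i\in\mathbb{C}$ satisfy $|\alpha_i|=\|(\mathbf{u}_i)_{S_i}\|_2$ and $\alpha_i\mathbf{u}_i^H\mathbf{e}_{j_i}\in\mathbb{R}$, and set $$\mathbf{v}_i=\frac{(\mathbf{u}_i-\alpha_i\mathbf{e}_{j_i})_{S_i}}{\|(\mathbf{u}_i-\alpha_i\mathbf{e}_{j_i})_{S_i}\|_2},\qquad\mathbf{H}_i=\mathbf{I}-2\mathbf{v}_i\mathbf{v}_i^H$$ (with $\mathbf{H}_i=\mathbf{I}$ if $(\mathbf{u}_i-\alpha_i\mathbf{e}_{j_i})_{S_i}=\mathbf{0}$). Then $\mathbf{D}_{post}=\mathbf{D}_{prior}\mathbf{H}_1\cdots\mathbf{H}_K$.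 *)

theory Defs
  imports "HOL-Analysis.Analysis"
begin

text \<open>Throughout, \<open>\<Omega>\<close> is \<open>UNIV :: 'n set\<close> and \<open>N = CARD('n)\<close>. The library norm on
  \<open>complex ^ 'n\<close> is the Euclidean 2-norm.\<close>

definition ctranspose :: "complex ^ 'n ^ 'm \<Rightarrow> complex ^ 'm ^ 'n"
  where "ctranspose A = (\<chi> a b. cnj (A $ b $ a))"

text \<open>\<open>x\<^sup>H y\<close>, conjugate linear in the first argument.\<close>
definition cdot :: "complex ^ 'n \<Rightarrow> complex ^ 'n \<Rightarrow> complex"
  where "cdot x y = (\<Sum>k\<in>UNIV. cnj (x $ k) * y $ k)"

text \<open>\<open>x y\<^sup>H\<close>\<close>
definition couter :: "complex ^ 'n \<Rightarrow> complex ^ 'n \<Rightarrow> complex ^ 'n ^ 'n"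
  where "couter x y = (\<chi> a b. x $ a * cnj (y $ b))"

definition frob_norm :: "complex ^ 'n ^ 'm \<Rightarrow> real"
  where "frob_norm A = sqrt (\<Sum>a\<in>UNIV. \<Sum>b\<in>UNIV. (cmod (A $ a $ b))\<^sup>2)"

definition vec_restrict :: "complex ^ 'n \<Rightarrow> 'n set \<Rightarrow> complex ^ 'n"
  where "vec_restrict a S = (\<chi> k. if k \<in> S then a $ k else 0)"

definition reflector :: "complex ^ 'n \<Rightarrow> complex ^ 'n ^ 'n"
  where "reflector x =
    (if x = 0 then mat 1
     else let v = x /\<^sub>R norm x in mat 1 - 2 *\<^sub>R couter v v)"

text \<open>\<open>H\<^sub>n \<cdots> H\<^sub>1\<close>\<close>
primrec rev_matprod :: "(nat \<Rightarrow> complex ^ 'n ^ 'n) \<Rightarrow> nat \<Rightarrow> complex ^ 'n ^ 'n"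
  where
    "rev_matprod H 0 = mat 1"
  | "rev_matprod H (Suc n) = H (Suc n) ** rev_matprod H n"

text \<open>\<open>H\<^sub>1 \<cdots> H\<^sub>n\<close>\<close>
primrec matprod :: "(nat \<Rightarrow> complex ^ 'n ^ 'n) \<Rightarrow> nat \<Rightarrow> complex ^ 'n ^ 'n"
  where
    "matprod H 0 = mat 1"
  | "matprod H (Suc n) = matprod H n ** H (Suc n)"

definition hot_vec ::
  "complex ^ 'n ^ 'n \<Rightarrow> (nat \<Rightarrow> complex ^ 'n) \<Rightarrow> (nat \<Rightarrow> complex ^ 'n ^ 'n) \<Rightarrow> nat \<Rightarrow> complex ^ 'n"
  where "hot_vec D r H i = rev_matprod H (i - 1) *v (ctranspose D *v r i)"

definition hot_index_set :: "(nat \<Rightarrow> 'n) \<Rightarrow> nat \<Rightarrow> 'n set"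
  where "hot_index_set j i = UNIV - j ` {1..<i}"

text \<open>\<open>H 1, \<dots>, H K\<close> are the factors of the construction with prior \<open>D\<close>, references
  \<open>r 1, \<dots>, r K\<close>, chosen indices \<open>j 1, \<dots>, j K\<close> and chosen scalars \<open>\<alpha> 1, \<dots>, \<alpha> K\<close>.
  The condition on \<open>H i\<close> only involves \<open>H 1, \<dots>, H (i - 1)\<close>, so \<open>D\<close>, \<open>r\<close>, \<open>j\<close>, \<open>\<alpha>\<close>
  determine \<open>H\<close> on \<open>{1..K}\<close>.\<close>
definition hot_factors ::
  "complex ^ 'n ^ 'n \<Rightarrow> nat \<Rightarrow> (nat \<Rightarrow> complex ^ 'n) \<Rightarrow> (nat \<Rightarrow> 'n) \<Rightarrow> (nat \<Rightarrow> complex)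
    \<Rightarrow> (nat \<Rightarrow> complex ^ 'n ^ 'n) \<Rightarrow> bool"
  where "hot_factors D K r j \<alpha> H \<longleftrightarrow>
    inj_on j {1..K} \<and>
    (\<forall>i\<in>{1..K}.
      let u = hot_vec D r H i; S = hot_index_set j i in
        cmod (\<alpha> i) = norm (vec_restrict u S) \<and>
        \<alpha> i * cdot u (axis (j i) 1) \<in> \<real> \<and>
        H i = reflector (vec_restrict (u - \<alpha> i *s axis (j i) 1) S))"

definition relative_error :: "complex ^ 'n ^ 'n \<Rightarrow> complex ^ 'n ^ 'n \<Rightarrow> real"
  where "relative_error A B = frob_norm (A - B) / frob_norm B"

definition correlation :: "complex ^ 'n ^ 'n \<Rightarrow> complex ^ 'n ^ 'n \<Rightarrow> real"
  where "correlation A B = 1 / real CARD('n) *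
    (\<Sum>k\<in>UNIV. cmod (cdot (column k A) (column k B)) / (norm (column k A) * norm (column k B)))"

end

theory Submission
  imports Defs
begin

text \<open>
  The Frobenius norm is the Euclidean norm of the space of matrices, whose real inner product
  is \<open>A \<bullet> B = Re (tr (A\<^sup>H B))\<close>.  Both bounds follow from one estimate on this number:
  \<open>Dprior \<bullet> Dpost \<ge> N - 2 K\<close>.

  The estimate accumulates over the factors.  If \<open>A\<close> and \<open>D\<close> preserve the 2-norm and
  \<open>v\<close> is a unit vector, then
  \<open>D \<bullet> (A (I - 2 v v\<^sup>H)) = D \<bullet> A - 2 (D v) \<bullet> (A v) \<ge> D \<bullet> A - 2\<close>
  by Cauchy-Schwarz, so each reflector costs at most 2, starting from \<open>D \<bullet> D = N\<close>
  (a factor \<open>I\<close> costs nothing).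

  Since \<open>Dprior\<close> and \<open>Dpost\<close> both have squared norm \<open>N\<close>, expanding the square gives
  \<open>\<parallel>Dpost - Dprior\<parallel>\<^sup>2 = 2 N - 2 Dprior \<bullet> Dpost \<le> 4 K\<close>, which is the error bound.
  All columns are unit vectors, so the correlation is the mean of the
  \<open>\<bar>Dpost\<^sub>k\<^sup>H Dprior\<^sub>k\<bar>\<close>, each of which dominates its real part; these real parts add up to
  \<open>Dpost \<bullet> Dprior\<close>, which is the correlation bound.
\<close>

section \<open>The real inner product behind the complex one\<close>

lemma Re_cdot: "Re (cdot x y) = x \<bullet> y"
  by (simp add: cdot_def inner_vec_def inner_complex_def)

lemma frob_norm_eq_norm: "frob_norm A = norm A"
  by (simp add: frob_norm_def norm_vec_def L2_set_def sum_nonneg)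

lemma inner_eq_sum_columns:
  fixes A B :: "complex ^ 'n ^ 'm"
  shows "A \<bullet> B = (\<Sum>k\<in>UNIV. column k A \<bullet> column k B)"
  unfolding inner_vec_def column_def by (subst sum.swap) simp

text \<open>The real part of \<open>tr (A\<^sup>H x y\<^sup>H) = y\<^sup>H A\<^sup>H x = (A y)\<^sup>H x\<close>; it turns the loss caused by a rank-one
  correction into an inner product of vectors.\<close>
lemma inner_couter: "A \<bullet> couter x y = (A *v y) \<bullet> x"
proof -
  have "A \<bullet> couter x y = (\<Sum>a\<in>UNIV. \<Sum>b\<in>UNIV. (A $ a $ b * y $ b) \<bullet> x $ a)"
    unfolding inner_vec_def couter_def
    by (intro sum.cong refl) (simp add: inner_complex_def algebra_simps)
  then show ?thesis
    by (simp add: inner_vec_def matrix_vector_mult_def inner_sum_left)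
qed

lemma matrix_mult_couter: "A ** couter x y = couter (A *v x) y"
  by (simp add: vec_eq_iff couter_def matrix_matrix_mult_def matrix_vector_mult_def
      sum_distrib_right mult.assoc)

lemma couter_mult_vec: "couter x y *v z = cdot y z *s x"
  by (simp add: vec_eq_iff couter_def cdot_def matrix_vector_mult_def
      sum_distrib_right sum_distrib_left mult_ac)

lemma scaleR_couter: "c *\<^sub>R couter x y = couter (c *\<^sub>R x) y"
  by (simp add: vec_eq_iff couter_def)

lemma matrix_mult_diff_right:
  fixes A :: "complex ^ 'n ^ 'm"
  shows "A ** (B - C) = A ** B - A ** C"
  by (simp add: vec_eq_iff matrix_matrix_mult_def sum_subtractf right_diff_distrib)

lemma matrix_mult_axis:
  fixes A :: "complex ^ 'n ^ 'm"
  shows "A *v axis k 1 = column k A"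
  by (simp add: vec_eq_iff matrix_vector_mult_def column_def axis_def if_distrib cong: if_cong)

lemma cdot_adjoint:
  fixes A :: "complex ^ 'n ^ 'm"
  shows "cdot (A *v x) y = cdot x (ctranspose A *v y)"
proof -
  have "cdot (A *v x) y = (\<Sum>a\<in>UNIV. \<Sum>b\<in>UNIV. cnj (A $ a $ b) * cnj (x $ b) * y $ a)"
    by (simp add: cdot_def matrix_vector_mult_def sum_distrib_right)
  also have "\<dots> = (\<Sum>b\<in>UNIV. \<Sum>a\<in>UNIV. cnj (A $ a $ b) * cnj (x $ b) * y $ a)"
    by (rule sum.swap)
  also have "\<dots> = cdot x (ctranspose A *v y)"
    by (simp add: cdot_def matrix_vector_mult_def ctranspose_def sum_distrib_left mult_ac)
  finally show ?thesis .
qed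

section \<open>Norm-preserving matrices\<close>

definition norm_preserving :: "complex ^ 'n ^ 'm \<Rightarrow> bool"
  where "norm_preserving A \<longleftrightarrow> (\<forall>x. norm (A *v x) = norm x)"

lemma norm_preservingD: "norm_preserving A \<Longrightarrow> norm (A *v x) = norm x"
  by (simp add: norm_preserving_def)

lemma norm_preserving_mult:
  "norm_preserving A \<Longrightarrow> norm_preserving B \<Longrightarrow> norm_preserving (A ** B)"
  by (simp add: norm_preserving_def flip: matrix_vector_mul_assoc)

lemma norm_preserving_if_ctranspose_mult:
  assumes "ctranspose A ** A = mat 1"
  shows "norm_preserving A"
  unfolding norm_preserving_def
proof
  fix x
  have "cdot (A *v x) (A *v x) = cdot x x"
    by (simp add: cdot_adjoint matrix_vector_mul_assoc assms)
  then have "(A *v x) \<bullet> (A *v x) = x \<bullet> x"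
    by (simp flip: Re_cdot)
  then show "norm (A *v x) = norm x"
    by (simp add: norm_eq_sqrt_inner)
qed

lemma norm_column_norm_preserving:
  assumes "norm_preserving A"
  shows "norm (column k A) = 1"
  using norm_preservingD[OF assms, of "axis k 1"]
  by (simp add: matrix_mult_axis)

lemma norm_sq_norm_preserving:
  fixes A :: "complex ^ 'n ^ 'm"
  assumes "norm_preserving A"
  shows "(norm A)\<^sup>2 = real CARD('n)"
proof -
  have "column k A \<bullet> column k A = 1" for k
    by (simp add: dot_square_norm norm_column_norm_preserving[OF assms])
  then show ?thesis
    by (simp add: power2_norm_eq_inner inner_eq_sum_columns)
qed

section \<open>Products of reflectors\<close>

text \<open>A reflector changes the sign of the component of \<open>x\<close> along \<open>v\<close>: with \<open>c = v\<^sup>H x\<close>, the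
  cross term \<open>-4 \<bar>c\<bar>\<^sup>2\<close> and the quadratic term \<open>4 \<bar>c\<bar>\<^sup>2\<close> of
  \<open>\<parallel>x - 2 c v\<parallel>\<^sup>2\<close> cancel.\<close>
lemma norm_preserving_unit_reflection:
  assumes "norm v = 1"
  shows "norm_preserving (mat 1 - 2 *\<^sub>R couter v v)"
  unfolding norm_preserving_def
proof
  fix x
  define c where "c = cdot v x"
  have app: "(mat 1 - 2 *\<^sub>R couter v v) *v x = x - 2 *\<^sub>R (c *s v)"
    by (simp add: matrix_vector_mult_diff_rdistrib c_def scaleR_couter couter_mult_vec)
      (simp add: vec_eq_iff)
  have "cdot x (c *s v) = c * cdot x v"
    by (simp add: cdot_def sum_distrib_left mult.left_commute)
  also have "cdot x v = cnj c"
    by (simp add: c_def cdot_def mult.commute)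
  finally have cross: "x \<bullet> (c *s v) = (cmod c)\<^sup>2"
    by (simp add: complex_norm_square[symmetric] flip: Re_cdot)
  have "(c *s v) \<bullet> (c *s v) = (\<Sum>k\<in>UNIV. (cmod c)\<^sup>2 * (cmod (v $ k))\<^sup>2)"
    by (simp add: inner_vec_def dot_square_norm norm_mult power_mult_distrib)
  also have "\<dots> = (cmod c)\<^sup>2 * (norm v)\<^sup>2"
    by (simp add: power2_norm_eq_inner inner_vec_def sum_distrib_left)
  finally have quad: "(c *s v) \<bullet> (c *s v) = (cmod c)\<^sup>2"
    using assms by simp
  have "(x - 2 *\<^sub>R (c *s v)) \<bullet> (x - 2 *\<^sub>R (c *s v)) = x \<bullet> x"
    using cross quad by (simp add: inner_diff_left inner_diff_right inner_commute[of "c *s v" x])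
  then show "norm ((mat 1 - 2 *\<^sub>R couter v v) *v x) = norm x"
    by (simp add: app norm_eq_sqrt_inner)
qed

lemma norm_preserving_reflector: "norm_preserving (reflector x)"
proof (cases "x = 0")
  case True
  then show ?thesis by (simp add: reflector_def norm_preserving_def)
next
  case False
  then show ?thesis
    by (simp add: reflector_def Let_def norm_preserving_unit_reflection)
qed

text \<open>The key estimate: a reflector with unit direction \<open>v\<close> subtracts
  \<open>2 (D v) \<bullet> (A v)\<close> from the inner product, and both vectors have length 1.\<close>
lemma inner_mult_reflector_ge:
  fixes A D :: "complex ^ 'n ^ 'n"
  assumes D: "norm_preserving D" and A: "norm_preserving A"
  shows "D \<bullet> (A ** reflector x) \<ge> D \<bullet> A - 2"
proof (cases "x = 0")
  case True
  then show ?thesis by (simp add: reflector_def)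
next
  case False
  define v where "v = x /\<^sub>R norm x"
  have "norm v = 1"
    using False by (simp add: v_def)
  have "A ** reflector x = A - A ** couter (2 *\<^sub>R v) v"
    using False
    by (simp add: reflector_def Let_def v_def[symmetric] matrix_mult_diff_right scaleR_couter)
  also have "\<dots> = A - 2 *\<^sub>R couter (A *v v) v"
    by (simp add: matrix_mult_couter scaleR_couter linear_scale[OF matrix_vector_mul_linear])
  finally have "D \<bullet> (A ** reflector x) = D \<bullet> A - 2 * ((D *v v) \<bullet> (A *v v))"
    by (simp add: inner_diff_right inner_couter)
  moreover have "(D *v v) \<bullet> (A *v v) \<le> 1"
    using norm_cauchy_schwarz[of "D *v v" "A *v v"] \<open>norm v = 1\<close>
    by (simp add: norm_preservingD[OF D] norm_preservingD[OF A])
  ultimately show ?thesis by simp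
qed

text \<open>The two claims are proved together because the key estimate needs the partial product
  to preserve norms.\<close>
lemma reflector_product:
  fixes D :: "complex ^ 'n ^ 'n"
  assumes D: "norm_preserving D"
    and H: "\<And>i. i \<in> {1..K} \<Longrightarrow> H i \<in> range reflector"
  shows "norm_preserving (D ** matprod H K)
    \<and> D \<bullet> (D ** matprod H K) \<ge> real CARD('n) - 2 * real K"
  using H
proof (induction K)
  case 0
  then show ?case
    using D by (simp add: norm_sq_norm_preserving flip: power2_norm_eq_inner)
next
  case (Suc K)
  let ?A = "D ** matprod H K"
  have IH: "norm_preserving ?A" "D \<bullet> ?A \<ge> real CARD('n) - 2 * real K"
    using Suc by auto
  obtain x where x: "H (Suc K) = reflector x"
    using Suc.prems[of "Suc K"] by auto
  have "D ** matprod H (Suc K) = ?A ** reflector x"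
    by (simp add: x matrix_mul_assoc)
  then show ?case
    using norm_preserving_mult[OF IH(1) norm_preserving_reflector[of x]]
      inner_mult_reflector_ge[OF D IH(1), of x] IH(2)
    by simp
qed

section \<open>Relative error and correlation\<close>

lemma relative_error_le:
  fixes A B :: "complex ^ 'n ^ 'n"
  assumes A: "norm_preserving A" and B: "norm_preserving B"
    and ge: "B \<bullet> A \<ge> real CARD('n) - 2 * c"
  shows "relative_error A B \<le> 2 * sqrt c / sqrt (real CARD('n))"
proof -
  have "(norm (A - B))\<^sup>2 = 2 * real CARD('n) - 2 * (B \<bullet> A)"
    using norm_sq_norm_preserving[OF A] norm_sq_norm_preserving[OF B]
    by (simp add: power2_norm_eq_inner inner_diff_left inner_diff_right inner_commute)
  then have "norm (A - B) \<le> sqrt (4 * c)"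
    using ge by (intro real_le_rsqrt) simp
  then have "norm (A - B) \<le> 2 * sqrt c"
    by (simp add: real_sqrt_mult)
  moreover have "norm B = sqrt (real CARD('n))"
    by (simp flip: norm_sq_norm_preserving[OF B])
  ultimately show ?thesis
    by (simp add: relative_error_def frob_norm_eq_norm divide_right_mono)
qed

lemma correlation_ge_inner:
  fixes A B :: "complex ^ 'n ^ 'n"
  assumes A: "norm_preserving A" and B: "norm_preserving B"
  shows "correlation A B \<ge> (A \<bullet> B) / real CARD('n)"
proof -
  have "A \<bullet> B \<le> (\<Sum>k\<in>UNIV. cmod (cdot (column k A) (column k B)))"
    unfolding inner_eq_sum_columns
    by (intro sum_mono) (metis Re_cdot complex_Re_le_cmod)
  then show ?thesis
    by (simp add: correlation_def norm_column_norm_preserving[OF A]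
        norm_column_norm_preserving[OF B] divide_right_mono)
qed

theorem theorem6:
  fixes Dprior Dpost :: "complex ^ 'n ^ 'n"
    and K :: nat
    and r :: "nat \<Rightarrow> complex ^ 'n"
    and j :: "nat \<Rightarrow> 'n"
    and \<alpha> :: "nat \<Rightarrow> complex"
    and H :: "nat \<Rightarrow> complex ^ 'n ^ 'n"
  assumes "ctranspose Dprior ** Dprior = mat 1"
    and "inj_on r {1..K}" and "vec.independent (r ` {1..K})"
    and "hot_factors Dprior K r j \<alpha> H"
    and "Dpost = Dprior ** matprod H K"
  shows "relative_error Dpost Dprior \<le> 2 * sqrt (real K) / sqrt (real CARD('n))
    \<and> correlation Dpost Dprior \<ge> 1 - 2 * real K / real CARD('n)"
proof -
  have prior: "norm_preserving Dprior"
    using assms(1) by (rule norm_preserving_if_ctranspose_mult)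
  have "H i \<in> range reflector" if "i \<in> {1..K}" for i
    using assms(4) that by (auto simp: hot_factors_def Let_def)
  then have post: "norm_preserving Dpost"
    and ge: "Dprior \<bullet> Dpost \<ge> real CARD('n) - 2 * real K"
    using reflector_product[OF prior, of K H] assms(5) by auto
  have "1 - 2 * real K / real CARD('n) = (real CARD('n) - 2 * real K) / real CARD('n)"
    by (simp add: field_simps)
  also have "\<dots> \<le> (Dpost \<bullet> Dprior) / real CARD('n)"
    using ge by (simp add: divide_right_mono inner_commute)
  also have "\<dots> \<le> correlation Dpost Dprior"
    by (rule correlation_ge_inner[OF post prior])
  finally show ?thesis
    using relative_error_le[OF post prior ge] by simp
qed

end
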